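(* Let $H$ be a real Hilbert space and let $F=f+g$, where $f:H\to\mathbb{R}$ is $\mu$-strongly convex and $L$-smooth with $L\ge\mu>0$, and $g:H\to\mathbb{R}\cup\{\infty\}$ is convex, proper and lower-semicontinuous. Assume $\operatorname{argmin}(F)\neq\emptyset$, let $x^*\in\operatorname{argmin}(F)$ and $F^*=F(x^* )$. Let $(x_k),(y_k),(z_k)$ be generated by (M-APM) with $s=\frac1L$ and $\gamma=\frac23$ from initial points $x_0,y_0\in H$. Then for every $k\ge2$, $$F(y_k)-F^*\le\frac{3L\|x_0-x^*\|^2}{4t_k(t_k-1)}(1+\rho)^{-k+2},\quad\text{with}\quad\rho=\frac{\mu}{3L+5\mu}.$$
   Context: $L$-smooth means $f$ is differentiable with $L$-Lipschitz gradient. $\mu$-strongly convex means $f-\frac{\mu}{2}\|\cdot\|^2$ is convex. $\operatorname{prox}_{sg}(v)=\operatorname{arg\,min}_{u\in H}\{g(u)+\frac{1}{2s}\|u-v\|^2\}$. The sequence $(t_k)_{k\ge0}$ is $t_0=1$, $t_k=\frac{1+\sqrt{1+4t_{k-1}^2}}{2}$ for $k\ge1$. Algorithm (M-APM) with parameters $s,\gamma$: given $x_0,y_0\in H$, for $k\ge0$, $$z_k=\operatorname{prox}_{sg}(x_k-s\nabla f(x_k)),\qquad y_{k+1}=\begin{cases}z_k,&\text{if }F(z_k)\le F(y_k),\\ y_k,&\text{otherwise},\end{cases}$$ $$x_{k+1}=y_{k+1}+\frac{t_k-1}{t_{k+1}}(y_{k+1}-y_k)+\frac{t_k}{t_{k+1}}(z_k-y_{k+1})+\frac{t_k(\gamma-1)}{t_{k+1}}(z_k-x_k).$$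 *)

theory Defs
  imports "HOL-Analysis.Analysis"
begin

text \<open>The type class \<open>{real_inner, complete_space}\<close> plays the role of a real Hilbert space. Functions
  with values in the reals extended by plus infinity have type \<open>'a \<Rightarrow> ereal\<close>; that they never take
  the value minus infinity is part of \<open>proper\<close>.\<close>

(* On a Hilbert space the description is satisfied at every point of differentiability, by the
   Riesz representation theorem. *)
definition gradient :: "('a::real_inner \<Rightarrow> real) \<Rightarrow> 'a \<Rightarrow> 'a" where
  "gradient f x = (THE D. GDERIV f x :> D)"

definition smooth :: "real \<Rightarrow> ('a::real_inner \<Rightarrow> real) \<Rightarrow> bool" where
  "smooth L f \<longleftrightarrow> (\<forall>x. f differentiable (at x)) \<and> L-lipschitz_on UNIV (gradient f)"

definition strongly_convex :: "real \<Rightarrow> ('a::real_inner \<Rightarrow> real) \<Rightarrow> bool" where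
  "strongly_convex \<mu> f \<longleftrightarrow> convex_on UNIV (\<lambda>x. f x - \<mu> / 2 * (norm x)\<^sup>2)"

definition proper :: "('a \<Rightarrow> ereal) \<Rightarrow> bool" where
  "proper g \<longleftrightarrow> (\<forall>x. g x \<noteq> - \<infinity>) \<and> (\<exists>x. g x \<noteq> \<infinity>)"

(* Used only together with proper, so the right-hand side never has the form \<infinity> - \<infinity>. *)
definition convex_ext :: "('a::real_vector \<Rightarrow> ereal) \<Rightarrow> bool" where
  "convex_ext g \<longleftrightarrow> (\<forall>x y. \<forall>u>0. \<forall>v>0. u + v = 1 \<longrightarrow>
     g (u *\<^sub>R x + v *\<^sub>R y) \<le> ereal u * g x + ereal v * g y)"

definition lsc :: "('a::topological_space \<Rightarrow> ereal) \<Rightarrow> bool" where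
  "lsc g \<longleftrightarrow> (\<forall>x. g x \<le> Liminf (at x) g)"

definition argmin :: "('a \<Rightarrow> ereal) \<Rightarrow> 'a set" where
  "argmin h = {u. is_arg_min h (\<lambda>_. True) u}"

(* For s > 0 and proper, convex, lower semicontinuous g on a Hilbert space there is exactly one
   minimiser, so the choice made by arg_min is immaterial. *)
definition prox :: "real \<Rightarrow> ('a::real_inner \<Rightarrow> ereal) \<Rightarrow> 'a \<Rightarrow> 'a" where
  "prox s g v = arg_min (\<lambda>u. g u + ereal (1 / (2 * s) * (norm (u - v))\<^sup>2)) (\<lambda>_. True)"

definition composite :: "('a \<Rightarrow> real) \<Rightarrow> ('a \<Rightarrow> ereal) \<Rightarrow> 'a \<Rightarrow> ereal" where
  "composite f g u = ereal (f u) + g u"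

primrec t_seq :: "nat \<Rightarrow> real" where
  "t_seq 0 = 1"
| "t_seq (Suc k) = (1 + sqrt (1 + 4 * (t_seq k)\<^sup>2)) / 2"

definition m_apm ::
  "('a::real_inner \<Rightarrow> real) \<Rightarrow> ('a \<Rightarrow> ereal) \<Rightarrow> real \<Rightarrow> real \<Rightarrow>
   (nat \<Rightarrow> 'a) \<Rightarrow> (nat \<Rightarrow> 'a) \<Rightarrow> (nat \<Rightarrow> 'a) \<Rightarrow> bool" where
  "m_apm f g s \<gamma> x y z \<longleftrightarrow>
    (\<forall>k. z k = prox s g (x k - s *\<^sub>R gradient f (x k)) \<and>
         y (Suc k) = (if composite f g (z k) \<le> composite f g (y k) then z k else y k) \<and>
         x (Suc k) = y (Suc k)
           + ((t_seq k - 1) / t_seq (Suc k)) *\<^sub>R (y (Suc k) - y k)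
           + (t_seq k / t_seq (Suc k)) *\<^sub>R (z k - y (Suc k))
           + (t_seq k * (\<gamma> - 1) / t_seq (Suc k)) *\<^sub>R (z k - x k))"

end

theory Submission
  imports Defs
begin

text \<open>With \<open>v k = t k *\<^sub>R x k - (t k - 1) *\<^sub>R y k\<close> and \<open>p k = x k - z k\<close> the extrapolation step reads
  \<open>v (k + 1) = v k - (\<gamma> * t k) *\<^sub>R p k\<close>. The energy
  \<open>E k = 4 / (3 * L) * t k * (t k - 1) * (F (y k) - F xstar) + (norm (v k - xstar))\<^sup>2\<close> satisfies
  \<open>E 0 = (norm (x 0 - xstar))\<^sup>2\<close>. Applying the prox-gradient inequality at \<open>y k\<close> and at \<open>xstar\<close>
  gives a decrease of the energy that contains positive multiples of \<open>(norm (p k))\<^sup>2\<close> (because \<open>\<gamma> < 1\<close>),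
  of \<open>(norm (x k - y k))\<^sup>2\<close> and of \<open>(norm (x k - xstar))\<^sup>2\<close> (because \<open>\<mu> > 0\<close>). By strong convexity
  \<open>F (z k) - F xstar\<close> is bounded by a multiple of \<open>(norm (p k))\<^sup>2\<close>, so the decrease dominates
  \<open>\<rho> * E (k + 1)\<close>.\<close>

section \<open>Proximal points and the Riesz representation\<close>

lemma proper_finite:
  assumes "proper g" "g u \<noteq> \<infinity>"
  obtains r where "g u = ereal r"
  using assms unfolding proper_def by (cases "g u") auto

lemma lsc_eventually_nhds:
  assumes "lsc g" "a < g z"
  shows "eventually (\<lambda>u. a < g u) (nhds z)"
  using assms unfolding lsc_def le_Liminf_iff eventually_nhds_conv_at by blast

lemma convex_ext_real:
  assumes "convex_ext g" "proper g" "g u = ereal a" "g w = ereal b" "0 < \<theta>" "\<theta> < 1"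
  obtains r where "g ((1 - \<theta>) *\<^sub>R u + \<theta> *\<^sub>R w) = ereal r" "r \<le> (1 - \<theta>) * a + \<theta> * b"
proof -
  have "g ((1 - \<theta>) *\<^sub>R u + \<theta> *\<^sub>R w) \<le> ereal (1 - \<theta>) * g u + ereal \<theta> * g w"
    using assms(1,5,6) by (simp add: convex_ext_def)
  then have le: "g ((1 - \<theta>) *\<^sub>R u + \<theta> *\<^sub>R w) \<le> ereal ((1 - \<theta>) * a + \<theta> * b)"
    using assms by simp
  then have "g ((1 - \<theta>) *\<^sub>R u + \<theta> *\<^sub>R w) \<noteq> \<infinity>" by auto
  with assms(2) obtain r where "g ((1 - \<theta>) *\<^sub>R u + \<theta> *\<^sub>R w) = ereal r"
    by (rule proper_finite)
  with le show thesis using that by simp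
qed

text \<open>Direct method: uniform convexity of the quadratic term makes a minimizing sequence
  Cauchy, completeness gives its limit, and lower semicontinuity shows that the infimum is attained
  there.\<close>

lemma prox_objective_attains_min:
  fixes g :: "'a::{real_inner, complete_space} \<Rightarrow> ereal"
  assumes g: "convex_ext g" "proper g" "lsc g" and "c > 0"
    and bdd: "\<And>u. ereal m \<le> g u + ereal (c * (norm (u - v))\<^sup>2)"
  shows "\<exists>z. \<forall>u. g z + ereal (c * (norm (z - v))\<^sup>2) \<le> g u + ereal (c * (norm (u - v))\<^sup>2)"
proof -
  define r where "r = (\<lambda>u. real_of_ereal (g u) + c * (norm (u - v))\<^sup>2)"
  define D where "D = {u. g u \<noteq> \<infinity>}"
  have gD: "g u = ereal (real_of_ereal (g u))" if "u \<in> D" for u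
    using that g(2) by (auto simp: D_def elim: proper_finite)
  have m: "m \<le> r u" if "u \<in> D" for u
    using bdd[of u] gD[OF that] unfolding r_def by (metis ereal_less_eq(3) plus_ereal.simps(1))
  have ne: "D \<noteq> {}" using g(2) by (auto simp: D_def proper_def)
  define I where "I = Inf (r ` D)"
  have bb: "bdd_below (r ` D)" using m by (auto simp: bdd_below_def)
  have I: "I \<le> r u" if "u \<in> D" for u
    unfolding I_def using bb that by (simp add: cInf_lower)
  have "\<exists>u\<in>D. r u < I + 1 / (real n + 1)" for n
    using cInf_lessD[of "r ` D" "I + 1 / (real n + 1)"] ne by (auto simp: I_def)
  then obtain X where X: "\<And>n. X n \<in> D" "\<And>n. r (X n) < I + 1 / (real n + 1)" by metis
  \<comment> \<open>Parallelogram law at the midpoint of \<open>u\<close> and \<open>w\<close>,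
    whose objective value is at least \<open>I\<close>.\<close>
  have mid: "c * (norm (u - w))\<^sup>2 / 4 \<le> (r u + r w) / 2 - I" if uw: "u \<in> D" "w \<in> D" for u w
  proof -
    obtain q where q: "g ((1 - 1/2) *\<^sub>R u + (1/2) *\<^sub>R w) = ereal q"
      "q \<le> (1 - 1/2) * real_of_ereal (g u) + (1/2) * real_of_ereal (g w)"
      using convex_ext_real[OF g(1,2) gD[OF uw(1)] gD[OF uw(2)], of "1/2"] by auto
    let ?h = "(1 - 1/2) *\<^sub>R u + (1/2) *\<^sub>R w"
    have "?h \<in> D" using q by (simp add: D_def)
    then have "I \<le> q + c * (norm (?h - v))\<^sup>2" using I[of ?h] q by (simp add: r_def)
    moreover have "?h - v = (1/2) *\<^sub>R ((u - v) + (w - v))"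
      by (simp add: algebra_simps) (simp flip: scaleR_add_left)
    then have "(norm (?h - v))\<^sup>2 = ((norm (u - v))\<^sup>2 + (norm (w - v))\<^sup>2) / 2 - (norm ((u - v) - (w - v)))\<^sup>2 / 4"
      unfolding power2_norm_eq_inner by (simp add: inner_simps inner_commute field_simps)
    then have "c * (norm (?h - v))\<^sup>2
        = (c * (norm (u - v))\<^sup>2 + c * (norm (w - v))\<^sup>2) / 2 - c * (norm (u - w))\<^sup>2 / 4"
      by (simp only: diff_diff_eq2 diff_add_cancel) (simp add: algebra_simps)
    ultimately show ?thesis using q(2) unfolding r_def by argo
  qed
  have XX: "c * (norm (X i - X j))\<^sup>2 / 4 \<le> 1 / real (Suc N)" if "N \<le> i" "N \<le> j" for N i j
  proof -
    have "1 / (real i + 1) \<le> 1 / real (Suc N)" "1 / (real j + 1) \<le> 1 / real (Suc N)"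
      using that by (auto intro!: frac_le)
    then show ?thesis using mid[OF X(1) X(1), of i j] X(2)[of i] X(2)[of j] by argo
  qed
  have "Cauchy X"
  proof (rule CauchyI)
    fix e :: real assume "e > 0"
    then obtain N where N: "1 / real (Suc N) < c * e\<^sup>2 / 4"
      using reals_Archimedean[of "c * e\<^sup>2 / 4"] \<open>c > 0\<close> by (auto simp: inverse_eq_divide)
    show "\<exists>M. \<forall>i\<ge>M. \<forall>j\<ge>M. norm (X i - X j) < e"
    proof (intro exI allI impI)
      fix i j assume "N \<le> i" "N \<le> j"
      from le_less_trans[OF XX[OF this] N] have "(norm (X i - X j))\<^sup>2 < e\<^sup>2"
        using \<open>c > 0\<close> by simp
      then show "norm (X i - X j) < e" using \<open>e > 0\<close> by (simp add: power_less_imp_less_base)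
    qed
  qed
  then obtain z where z: "X \<longlonglongrightarrow> z" using Cauchy_convergent convergent_def by blast
  have bound: "(\<lambda>n. I + 1 / (real n + 1) - c * (norm (X n - v))\<^sup>2) \<longlonglongrightarrow> I + 0 - c * (norm (z - v))\<^sup>2"
    using LIMSEQ_inverse_real_of_nat
    by (intro tendsto_intros z) (simp add: inverse_eq_divide add.commute)
  \<comment> \<open>Every real below \<open>g z\<close> is eventually below \<open>g (X n)\<close>,
    hence below the sequence in \<open>bound\<close>, and so at most its limit.\<close>
  have gz: "g z \<le> ereal (I - c * (norm (z - v))\<^sup>2)"
  proof (rule dense_le)
    fix a assume "a < g z"
    then have "eventually (\<lambda>u. a < g u) (nhds z)" by (rule lsc_eventually_nhds[OF g(3)])
    then have ev: "eventually (\<lambda>n. a < g (X n)) sequentially"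
      using z by (rule eventually_compose_filterlim)
    show "a \<le> ereal (I - c * (norm (z - v))\<^sup>2)"
    proof (cases a)
      case (real b)
      have "eventually (\<lambda>n. b \<le> I + 1 / (real n + 1) - c * (norm (X n - v))\<^sup>2) sequentially"
        using ev
      proof eventually_elim
        case (elim n)
        have "ereal b < ereal (real_of_ereal (g (X n)))" using elim real gD[OF X(1), of n] by simp
        then show ?case using X(2)[of n] by (simp add: r_def)
      qed
      then have "b \<le> I + 0 - c * (norm (z - v))\<^sup>2"
        by (intro tendsto_lowerbound[OF bound]) auto
      then show ?thesis using real by simp
    qed (use \<open>a < g z\<close> in auto)
  qed
  show ?thesis
  proof (intro exI allI)
    fix u
    show "g z + ereal (c * (norm (z - v))\<^sup>2) \<le> g u + ereal (c * (norm (u - v))\<^sup>2)"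
    proof (cases "u \<in> D")
      case True
      have "g z + ereal (c * (norm (z - v))\<^sup>2) \<le> ereal (I - c * (norm (z - v))\<^sup>2) + ereal (c * (norm (z - v))\<^sup>2)"
        by (rule add_right_mono[OF gz])
      also have "\<dots> = ereal I" by simp
      also have "\<dots> \<le> ereal (r u)" using I[OF True] by simp
      also have "\<dots> = g u + ereal (c * (norm (u - v))\<^sup>2)"
        by (subst gD[OF True]) (simp add: r_def)
      finally show ?thesis .
    qed (simp add: D_def)
  qed
qed

text \<open>Compare \<open>z\<close> with \<open>z + \<theta> *\<^sub>R (u - z)\<close> and let \<open>\<theta>\<close> tend to 0.\<close>

lemma prox_objective_variational:
  fixes g :: "'a::real_inner \<Rightarrow> ereal"
  assumes g: "convex_ext g" "proper g"
    and min: "\<And>u. g z + ereal (c * (norm (z - v))\<^sup>2) \<le> g u + ereal (c * (norm (u - v))\<^sup>2)"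
    and fin: "g z = ereal a" "g u = ereal b"
  shows "a + 2 * c * inner (v - z) (u - z) \<le> b"
proof -
  define Q where "Q = c * (norm (u - z))\<^sup>2"
  define A where "A = a + 2 * c * inner (v - z) (u - z) - b"
  have *: "A \<le> \<theta> * Q" if \<theta>: "0 < \<theta>" "\<theta> < 1" for \<theta>
  proof -
    obtain q where q: "g ((1 - \<theta>) *\<^sub>R z + \<theta> *\<^sub>R u) = ereal q" "q \<le> (1 - \<theta>) * a + \<theta> * b"
      using convex_ext_real[OF g fin \<theta>] by blast
    have "a + c * (norm (z - v))\<^sup>2 \<le> q + c * (norm ((1 - \<theta>) *\<^sub>R z + \<theta> *\<^sub>R u - v))\<^sup>2"
      using min[of "(1 - \<theta>) *\<^sub>R z + \<theta> *\<^sub>R u"] q fin by simp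
    moreover have "(1 - \<theta>) *\<^sub>R z + \<theta> *\<^sub>R u - v = (z - v) + \<theta> *\<^sub>R (u - z)"
      by (simp add: algebra_simps)
    moreover have "c * (norm ((z - v) + \<theta> *\<^sub>R (u - z)))\<^sup>2
        = c * (norm (z - v))\<^sup>2 - \<theta> * (2 * c * inner (v - z) (u - z)) + \<theta> * (\<theta> * Q)"
      unfolding Q_def power2_norm_eq_inner by (simp add: inner_simps inner_commute algebra_simps)
    ultimately have "\<theta> * A \<le> \<theta> * (\<theta> * Q)" using q(2) by (simp add: A_def algebra_simps)
    then show ?thesis using \<theta> by simp
  qed
  have "((\<lambda>\<theta>. \<theta> * Q) \<longlongrightarrow> 0 * Q) (at_right 0)" by (intro tendsto_intros)
  moreover have "eventually (\<lambda>\<theta>. A \<le> \<theta> * Q) (at_right (0::real))"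
    using * by (auto simp: eventually_at_right[of 0 1] intro!: exI[of _ 1])
  ultimately have "A \<le> 0" using tendsto_lowerbound[of "\<lambda>\<theta>. \<theta> * Q" "0 * Q"] by simp
  then show ?thesis by (simp add: A_def)
qed

text \<open>The representing vector is the minimizer of
  \<open>(norm u)\<^sup>2 / 2 - \<phi> u\<close>, a proximal problem for \<open>- \<phi>\<close> at
  0. Its variational inequality bounds \<open>\<phi> h\<close> on one side; \<open>- h\<close> gives
  the other.\<close>

lemma riesz_representation:
  fixes \<phi> :: "'a::{real_inner, complete_space} \<Rightarrow> real"
  assumes "bounded_linear \<phi>"
  shows "\<exists>z. \<forall>h. \<phi> h = inner h z"
proof -
  interpret bounded_linear \<phi> by fact
  define g where "g = (\<lambda>u. ereal (- \<phi> u))"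
  have pr: "proper g" by (auto simp: proper_def g_def)
  have cv: "convex_ext g" by (auto simp: convex_ext_def g_def add scaleR)
  have "(g \<longlongrightarrow> g x) (at x)" for x
    unfolding g_def by (intro tendsto_intros tendsto)
  \<comment> \<open>In the zero space \<open>at x\<close> is the trivial filter, where the limit
    says nothing but the \<open>Liminf\<close> is top.\<close>
  then have ls: "lsc g" unfolding lsc_def
    by (metis Liminf_bot lim_imp_Liminf order_refl top_greatest trivial_limit_def)
  obtain K where K: "\<And>h. norm (\<phi> h) \<le> norm h * K" using bounded by blast
  have "ereal (- (K\<^sup>2) / 2) \<le> g u + ereal (1 / 2 * (norm (u - 0))\<^sup>2)" for u
  proof -
    have "\<phi> u \<le> norm u * K" using K[of u] by simp
    moreover have "0 \<le> (norm u - K)\<^sup>2" by simp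
    ultimately show ?thesis by (simp add: g_def power2_diff)
  qed
  then obtain z where z: "\<And>u. g z + ereal (1 / 2 * (norm (z - 0))\<^sup>2) \<le> g u + ereal (1 / 2 * (norm (u - 0))\<^sup>2)"
    using prox_objective_attains_min[OF cv pr ls, of "1/2" "- (K\<^sup>2) / 2" 0] by auto
  have le: "\<phi> h \<le> inner h z" for h
    using prox_objective_variational[OF cv pr z, of "- \<phi> z" "z + h" "- \<phi> (z + h)"]
    by (simp add: g_def add inner_commute)
  have "\<phi> h = inner h z" for h
    using le[of h] le[of "- h"] by (simp add: neg)
  then show ?thesis by blast
qed

section \<open>Smooth strongly convex functions\<close>

text \<open>Riesz gives existence and uniqueness of derivatives gives uniqueness, so the description
  in \<open>gradient\<close> denotes.\<close>

lemma GDERIV_gradient: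
  fixes f :: "'a::{real_inner, complete_space} \<Rightarrow> real"
  assumes "f differentiable (at x)"
  shows "GDERIV f x :> gradient f x"
proof -
  obtain f' where f': "(f has_derivative f') (at x)" using assms by (auto simp: differentiable_def)
  obtain D where "\<forall>h. f' h = inner h D"
    using riesz_representation[OF has_derivative_bounded_linear[OF f']] by blast
  then have "f' = (\<lambda>h. inner h D)" by auto
  with f' have D: "GDERIV f x :> D" by (simp add: gderiv_def)
  have "E = D" if "GDERIV f x :> E" for E
  proof -
    have "(\<lambda>h. inner h E) = (\<lambda>h. inner h D)"
      using that D unfolding gderiv_def by (rule has_derivative_unique)
    then have "inner (E - D) E = inner (E - D) D" by meson
    then have "inner (E - D) (E - D) = 0" by (simp add: inner_diff_right)
    then show ?thesis by simp
  qed
  with D show ?thesis unfolding gradient_def by (rule theI)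
qed

lemma DERIV_gradient_line:
  fixes f :: "'a::{real_inner, complete_space} \<Rightarrow> real"
  assumes "\<And>x. f differentiable (at x)"
  shows "((\<lambda>\<tau>. f (x + \<tau> *\<^sub>R d)) has_real_derivative inner d (gradient f (x + \<tau> *\<^sub>R d))) (at \<tau>)"
proof -
  have "((\<lambda>\<tau>. x + \<tau> *\<^sub>R d) has_derivative (\<lambda>h. h *\<^sub>R d)) (at \<tau>)"
    by (auto intro!: derivative_eq_intros)
  from has_derivative_compose[OF this GDERIV_gradient[OF assms, unfolded gderiv_def]]
  show ?thesis
    unfolding has_field_derivative_def by (rule has_derivative_eq_rhs) (simp add: fun_eq_iff)
qed

text \<open>By the Lipschitz bound, \<open>f\<close> along the segment minus its linear part and the
  quadratic term is nonincreasing.\<close>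

lemma smooth_descent:
  fixes f :: "'a::{real_inner, complete_space} \<Rightarrow> real"
  assumes "smooth L f"
  shows "f u \<le> f x + inner (gradient f x) (u - x) + L / 2 * (norm (u - x))\<^sup>2"
proof -
  define d where "d = u - x"
  define \<psi> where "\<psi> = (\<lambda>\<tau>. f (x + \<tau> *\<^sub>R d) - \<tau> * inner d (gradient f x) - L / 2 * (norm d)\<^sup>2 * \<tau>\<^sup>2)"
  have diff: "\<And>x. f differentiable (at x)" and lip: "L-lipschitz_on UNIV (gradient f)"
    using assms by (auto simp: smooth_def)
  have "\<psi> 1 \<le> \<psi> 0"
  proof (rule DERIV_nonpos_imp_nonincreasing[of 0 1 \<psi>])
    fix \<tau> :: real assume \<tau>: "0 \<le> \<tau>" "\<tau> \<le> 1"
    let ?D = "inner d (gradient f (x + \<tau> *\<^sub>R d)) - inner d (gradient f x) - L / 2 * (norm d)\<^sup>2 * (2 * \<tau>)"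
    have "(\<psi> has_real_derivative ?D) (at \<tau>)"
      unfolding \<psi>_def by (rule derivative_eq_intros DERIV_gradient_line diff refl | simp)+
    moreover have "inner d (gradient f (x + \<tau> *\<^sub>R d) - gradient f x) \<le> norm d * (L * (\<tau> * norm d))"
    proof -
      have "norm (gradient f (x + \<tau> *\<^sub>R d) - gradient f x) \<le> L * (\<tau> * norm d)"
        using lipschitz_onD[OF lip, of "x + \<tau> *\<^sub>R d" x] \<tau> by (simp add: dist_norm)
      then show ?thesis
        by (intro order_trans[OF norm_cauchy_schwarz] mult_left_mono) auto
    qed
    then have "?D \<le> 0" by (simp add: inner_diff_right power2_eq_square algebra_simps)
    ultimately show "\<exists>y. (\<psi> has_real_derivative y) (at \<tau>) \<and> y \<le> 0" by blast
  qed simp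
  then show ?thesis by (simp add: \<psi>_def d_def inner_commute)
qed

text \<open>Tangent inequality on a line for the convex function left after removing the quadratic,
  which is then added back.\<close>

lemma strongly_convex_gradient:
  fixes f :: "'a::{real_inner, complete_space} \<Rightarrow> real"
  assumes sc: "strongly_convex \<mu> f" and diff: "\<And>x. f differentiable (at x)"
  shows "f x + inner (gradient f x) (u - x) + \<mu> / 2 * (norm (u - x))\<^sup>2 \<le> f u"
proof -
  define d where "d = u - x"
  define h where "h = (\<lambda>x. f x - \<mu> / 2 * (norm x)\<^sup>2)"
  define \<psi> where "\<psi> = (\<lambda>\<tau>. h (x + \<tau> *\<^sub>R d))"
  have h: "convex_on UNIV h" using sc by (simp add: strongly_convex_def h_def)
  have "convex_on UNIV \<psi>"
  proof (rule convex_onI)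
    fix t a b :: real assume "0 < t" "t < 1"
    moreover have "x + ((1 - t) *\<^sub>R a + t *\<^sub>R b) *\<^sub>R d = (1 - t) *\<^sub>R (x + a *\<^sub>R d) + t *\<^sub>R (x + b *\<^sub>R d)"
      by (simp add: algebra_simps)
    ultimately show "\<psi> ((1 - t) *\<^sub>R a + t *\<^sub>R b) \<le> (1 - t) * \<psi> a + t * \<psi> b"
      unfolding \<psi>_def using convex_onD[OF h, of t "x + a *\<^sub>R d" "x + b *\<^sub>R d"] by simp
  qed simp
  moreover have "((\<lambda>\<tau>. \<mu> / 2 * (norm (x + \<tau> *\<^sub>R d))\<^sup>2) has_real_derivative \<mu> * inner x d) (at 0)"
    unfolding power2_norm_eq_inner
    by (auto simp: inner_simps inner_commute intro!: derivative_eq_intros)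
  then have "(\<psi> has_real_derivative inner d (gradient f x) - \<mu> * inner x d) (at 0)"
    unfolding \<psi>_def h_def using DERIV_gradient_line[OF diff, of x d 0]
    by (auto intro!: derivative_intros)
  ultimately have "(inner d (gradient f x) - \<mu> * inner x d) * (1 - 0) \<le> \<psi> 1 - \<psi> 0"
    by (intro convex_on_imp_above_tangent[of UNIV]) auto
  moreover have "(norm (x + d))\<^sup>2 = (norm x)\<^sup>2 + 2 * inner x d + (norm d)\<^sup>2"
    unfolding power2_norm_eq_inner by (simp add: inner_simps inner_commute)
  ultimately have "f x + inner d (gradient f x) + \<mu> / 2 * (norm d)\<^sup>2 \<le> f (x + d)"
    by (simp add: \<psi>_def h_def field_simps)
  then show ?thesis by (simp add: d_def inner_commute)
qed

section \<open>The prox-gradient step\<close>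

lemma composite_eq_ereal_iff: "composite f g u = ereal c \<longleftrightarrow> g u = ereal (c - f u)"
  by (cases "g u") (auto simp: composite_def)

lemma composite_argmin_finite:
  assumes "proper g" "xstar \<in> argmin (composite f g)"
  obtains m where "composite f g xstar = ereal m" "\<And>u. ereal m \<le> composite f g u"
proof -
  have le: "composite f g xstar \<le> composite f g u" for u
    using assms(2) by (auto simp: argmin_def is_arg_min_def not_less)
  obtain u where "g u \<noteq> \<infinity>" using assms(1) by (auto simp: proper_def)
  then have "composite f g xstar \<noteq> \<infinity>" using le[of u] by (auto simp: composite_def)
  then have "g xstar \<noteq> \<infinity>" by (auto simp: composite_def)
  then obtain r where "g xstar = ereal r" by (rule proper_finite[OF assms(1)])
  then have "composite f g xstar = ereal (f xstar + r)" by (simp add: composite_def)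
  then show thesis using that le by simp
qed

text \<open>The quadratic upper model of \<open>f\<close> at \<open>x\<close> shows that the objective of the proximal problem is
  bounded below by the minimum of \<open>composite f g\<close> up to a constant; so no affine minorant of \<open>g\<close> is
  needed for the existence of the proximal point.\<close>

lemma prox_gradient_is_min:
  fixes f :: "'a::{real_inner, complete_space} \<Rightarrow> real"
  assumes sm: "smooth L f" and "L > 0" and g: "convex_ext g" "proper g" "lsc g"
    and lb: "\<And>u. ereal m \<le> composite f g u"
    and v: "v = x - (1 / L) *\<^sub>R gradient f x" and z: "z = prox (1 / L) g v"
  shows "g z + ereal (L / 2 * (norm (z - v))\<^sup>2) \<le> g u + ereal (L / 2 * (norm (u - v))\<^sup>2)"
proof -
  \<comment> \<open>Completing the square: up to a constant, the quadratic model is centered at the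
    gradient step \<open>v\<close>.\<close>
  have eq: "inner (gradient f x) (u - x) + L / 2 * (norm (u - x))\<^sup>2
      = L / 2 * (norm (u - v))\<^sup>2 - (norm (gradient f x))\<^sup>2 / (2 * L)" for u
    unfolding v power2_norm_eq_inner using \<open>L > 0\<close>
    by (simp add: inner_simps inner_commute field_simps)
  define C where "C = m - f x + (norm (gradient f x))\<^sup>2 / (2 * L)"
  have "ereal C \<le> g u + ereal (L / 2 * (norm (u - v))\<^sup>2)" for u
  proof (cases "g u = \<infinity>")
    case False
    then obtain r where r: "g u = ereal r" using g(2) by (auto elim: proper_finite)
    have "m \<le> f u + r" using lb[of u] r by (simp add: composite_def)
    with smooth_descent[OF sm, of u x] eq[of u] show ?thesis by (simp add: r C_def)
  qed simp
  then obtain w where w: "\<forall>u. g w + ereal (L / 2 * (norm (w - v))\<^sup>2) \<le> g u + ereal (L / 2 * (norm (u - v))\<^sup>2)"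
    using prox_objective_attains_min[OF g, of "L / 2" C v] \<open>L > 0\<close> by auto
  let ?q = "\<lambda>u. g u + ereal (L / 2 * (norm (u - v))\<^sup>2)"
  have "is_arg_min ?q (\<lambda>_. True) w" using w by (simp add: is_arg_min_def not_less)
  then have "is_arg_min ?q (\<lambda>_. True) (arg_min ?q (\<lambda>_. True))"
    unfolding arg_min_def by (rule someI)
  moreover have "z = arg_min ?q (\<lambda>_. True)" by (simp add: z prox_def)
  ultimately have "is_arg_min ?q (\<lambda>_. True) z" by simp
  then show ?thesis by (simp add: is_arg_min_def not_less)
qed

text \<open>Sum of three bounds: optimality of \<open>z\<close> in the proximal problem, strong
  convexity from \<open>x\<close> to \<open>u\<close>, and descent from \<open>x\<close> to
  \<open>z\<close>.\<close>

lemma prox_gradient_inequality: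
  fixes f :: "'a::{real_inner, complete_space} \<Rightarrow> real"
  assumes sm: "smooth L f" and sc: "strongly_convex \<mu> f" and L: "L > 0"
    and g: "convex_ext g" "proper g" "lsc g"
    and lb: "\<And>u. ereal m \<le> composite f g u"
    and z: "z = prox (1 / L) g (x - (1 / L) *\<^sub>R gradient f x)"
  obtains c where "composite f g z = ereal c"
    "\<And>u b. composite f g u = ereal b \<Longrightarrow>
      c + L / 2 * (norm (x - z))\<^sup>2 + \<mu> / 2 * (norm (x - u))\<^sup>2 \<le> b + L * inner (x - z) (x - u)"
proof -
  define v where "v = x - (1 / L) *\<^sub>R gradient f x"
  have min: "g z + ereal (L / 2 * (norm (z - v))\<^sup>2) \<le> g u + ereal (L / 2 * (norm (u - v))\<^sup>2)" for u
    using prox_gradient_is_min[OF sm L g lb v_def] z by (simp add: v_def)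
  obtain w where w: "g w \<noteq> \<infinity>" using g(2) by (auto simp: proper_def)
  with min[of w] have "g z \<noteq> \<infinity>" by auto
  then obtain a where a: "g z = ereal a" by (rule proper_finite[OF g(2)])
  have "f z + a + L / 2 * (norm (x - z))\<^sup>2 + \<mu> / 2 * (norm (x - u))\<^sup>2 \<le> b + L * inner (x - z) (x - u)"
    if "composite f g u = ereal b" for u b
  proof -
    have b: "g u = ereal (b - f u)" using that by (simp add: composite_eq_ereal_iff)
    have 1: "a + L * inner (v - z) (u - z) \<le> b - f u"
      using prox_objective_variational[OF g(1,2) min a b] by simp
    have diff: "\<And>x. f differentiable (at x)" using sm by (simp add: smooth_def)
    note 2 = strongly_convex_gradient[OF sc diff, of x u] smooth_descent[OF sm, of z x]
    \<comment> \<open>The gradient contained in \<open>v\<close> cancels the two explicit gradient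
      terms.\<close>
    have "L * inner (v - z) (u - z) + inner (gradient f x) (u - x) - inner (gradient f x) (z - x)
      = L * (norm (x - z))\<^sup>2 - L * inner (x - z) (x - u)"
      unfolding v_def power2_norm_eq_inner using L by (simp add: inner_simps inner_commute algebra_simps)
    with 1 2 show ?thesis by (simp add: norm_minus_commute[of _ x] algebra_simps)
  qed
  then show thesis using that[of "f z + a"] a by (simp add: composite_def)
qed

section \<open>Energy decay\<close>

lemma t_seq_ge_1: "t_seq k \<ge> 1"
proof (induction k)
  case (Suc k)
  have "1 \<le> sqrt (1 + 4 * (t_seq k)\<^sup>2)" by simp
  then show ?case by simp
qed simp

text \<open>\<open>t_seq (Suc k)\<close> is the positive root of
  \<open>r\<^sup>2 - r = (t_seq k)\<^sup>2\<close>. This turns the energy weight at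
  \<open>k + 1\<close> into the square produced by one step.\<close>

lemma t_seq_Suc_mult: "t_seq (Suc k) * (t_seq (Suc k) - 1) = (t_seq k)\<^sup>2"
proof -
  have "(sqrt (1 + 4 * (t_seq k)\<^sup>2))\<^sup>2 = 1 + 4 * (t_seq k)\<^sup>2" by simp
  then show ?thesis by (simp add: field_simps power2_eq_square)
qed

text \<open>One step of the algorithm, with \<open>a = x k - y k\<close>, \<open>b = x k - xstar\<close>, \<open>p = x k - z k\<close> and with
  \<open>dy\<close>, \<open>dz\<close>, \<open>dn\<close> the gaps \<open>F - F xstar\<close> at \<open>y k\<close>, \<open>z k\<close> and \<open>y (k + 1)\<close>. The hypothesis on \<open>dy\<close>
  carries the factor \<open>t - 1\<close> because \<open>F (y 0)\<close> may be infinite, and \<open>t = 1\<close> for \<open>k = 0\<close>.\<close>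

lemma energy_step:
  fixes a b p :: "'a::real_inner"
  assumes \<mu>: "0 < \<mu>" "\<mu> \<le> L" and t: "1 \<le> t" and \<rho>: "\<rho> = \<mu> / (3 * L + 5 * \<mu>)"
    and dn: "dn \<le> dz"
    and b: "dz + L / 2 * (norm p)\<^sup>2 + \<mu> / 2 * (norm b)\<^sup>2 \<le> L * inner p b"
    and a: "(t - 1) * (dz + L / 2 * (norm p)\<^sup>2 + \<mu> / 2 * (norm a)\<^sup>2) \<le> (t - 1) * (dy + L * inner p a)"
  defines "w \<equiv> (t - 1) *\<^sub>R a + b"
  shows "(1 + \<rho>) * (4 / (3 * L) * t\<^sup>2 * dn + (norm (w - (2 / 3 * t) *\<^sub>R p))\<^sup>2)
    \<le> 4 / (3 * L) * (t * (t - 1)) * dy + (norm w)\<^sup>2"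
proof -
  define P where "P = (norm p)\<^sup>2"
  define Q where "Q = (t - 1) * (norm a)\<^sup>2 + (norm b)\<^sup>2"
  define Z where "Z = 4 / (3 * L) * t\<^sup>2 * dz"
  define N where "N = (norm (w - (2 / 3 * t) *\<^sub>R p))\<^sup>2"
  define W where "W = (norm w)\<^sup>2"
  have L: "L > 0" using \<mu> by simp
  have \<rho>0: "\<rho> > 0" using \<mu> L by (simp add: \<rho>)
  have P0: "P \<ge> 0" by (simp add: P_def)
  have Q0: "Q \<ge> 0" using t by (simp add: Q_def)
  have pw: "inner p w = (t - 1) * inner p a + inner p b" by (simp add: w_def inner_simps)
  \<comment> \<open>Hypothesis \<open>a\<close> already carries the weight \<open>t - 1\<close>;
    adding \<open>b\<close> merges the displacements into \<open>w\<close>.\<close>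
  have "t * dz + t * (L / 2 * P) + \<mu> / 2 * Q \<le> (t - 1) * dy + L * inner p w"
    using a b unfolding pw P_def Q_def by (simp add: field_simps)
  \<comment> \<open>This factor makes the \<open>inner p w\<close> term cancel the one in the
    expansion of \<open>N\<close>.\<close>
  then have "4 / (3 * L) * t * (t * dz + t * (L / 2 * P) + \<mu> / 2 * Q)
      \<le> 4 / (3 * L) * t * ((t - 1) * dy + L * inner p w)"
    using t L by (intro mult_left_mono) auto
  moreover have "N = W - 4 / 3 * t * inner p w + 4 / 9 * t\<^sup>2 * P"
    unfolding N_def W_def P_def power2_norm_eq_inner
    by (simp add: inner_simps inner_commute power2_eq_square algebra_simps)
  moreover have "4 / (3 * L) * t * (t * dz + t * (L / 2 * P) + \<mu> / 2 * Q)
      = 4 / (3 * L) * t\<^sup>2 * dz + 2 / 3 * t\<^sup>2 * P + 2 / 3 * t * (\<mu> / L) * Q"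
    using L by (simp add: field_simps power2_eq_square)
  moreover have "4 / (3 * L) * t * ((t - 1) * dy + L * inner p w)
      = 4 / (3 * L) * (t * (t - 1)) * dy + 4 / 3 * t * inner p w"
    using L by (simp add: field_simps)
  \<comment> \<open>The surplus \<open>2 / 9 = 2 / 3 - 4 / 9\<close> in front of
    \<open>t\<^sup>2 * P\<close> comes from \<gamma> = 2/3.\<close>
  ultimately have decrease: "4 / (3 * L) * t\<^sup>2 * dz + N + (2 / 9 * t\<^sup>2 * P + 2 / 3 * t * (\<mu> / L) * Q)
      \<le> 4 / (3 * L) * (t * (t - 1)) * dy + W"
    by linarith
  \<comment> \<open>Young's inequality, weighted so that \<open>(norm b)\<^sup>2\<close> drops out
    and \<open>P\<close> alone controls \<open>dz\<close>.\<close>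
  have "0 \<le> (norm (L *\<^sub>R p - \<mu> *\<^sub>R b))\<^sup>2" by simp
  also have "\<dots> = L\<^sup>2 * P - 2 * \<mu> * (L * inner p b) + \<mu>\<^sup>2 * (norm b)\<^sup>2"
    unfolding P_def power2_norm_eq_inner
    by (simp add: inner_simps inner_commute power2_eq_square algebra_simps)
  finally have "2 * \<mu> * (L * inner p b) \<le> L\<^sup>2 * P + \<mu>\<^sup>2 * (norm b)\<^sup>2" by simp
  moreover have "2 * \<mu> * (dz + L / 2 * P + \<mu> / 2 * (norm b)\<^sup>2) \<le> 2 * \<mu> * (L * inner p b)"
    using b \<mu> by (intro mult_left_mono) (auto simp: P_def)
  ultimately have dz: "2 * \<mu> * dz \<le> (L - \<mu>) * L * P"
    by (simp add: power2_eq_square algebra_simps)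
  \<comment> \<open>Jensen's inequality for the squared norm, with its exact defect:
    \<open>w\<close> is \<open>t\<close> times a convex combination of \<open>a\<close> and
    \<open>b\<close>.\<close>
  have "W = t * Q - (t - 1) * (norm (a - b))\<^sup>2"
    unfolding W_def Q_def w_def power2_norm_eq_inner
    by (simp add: inner_simps inner_commute algebra_simps)
  then have W: "W \<le> t * Q" using t by simp
  \<comment> \<open>Parallelogram law; dropping the second square bounds \<open>N\<close>.\<close>
  have "N + (norm (w + (2 / 3 * t) *\<^sub>R p))\<^sup>2 = 2 * W + 8 / 9 * t\<^sup>2 * P"
    unfolding N_def W_def P_def power2_norm_eq_inner
    by (simp add: inner_simps inner_commute power2_eq_square algebra_simps)
  then have N: "N \<le> 2 * (t * Q) + 8 / 9 * t\<^sup>2 * P" using W by (smt (verit) zero_le_power2)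
  have D: "3 * L + 5 * \<mu> > 0" using \<mu> L by simp
  \<comment> \<open>Here \<rho> meets the budget: \<open>dz\<close> costs
    \<open>2 / 9 - 16 / 9 * \<rho>\<close> of \<open>t\<^sup>2 * P\<close> and \<open>N\<close>
    costs \<open>8 / 9 * \<rho>\<close>, within the available \<open>2 / 9\<close>. The
    \<open>Q\<close> part needs only \<open>\<rho> \<le> \<mu> / (3 * L)\<close>.\<close>
  have "\<rho> * (4 / (3 * L) * t\<^sup>2 * dz) = 2 / (3 * L * (3 * L + 5 * \<mu>)) * t\<^sup>2 * (2 * \<mu> * dz)"
    using L D by (simp add: \<rho> field_simps)
  also have "\<dots> \<le> 2 / (3 * L * (3 * L + 5 * \<mu>)) * t\<^sup>2 * ((L - \<mu>) * L * P)"
    using dz L D by (intro mult_left_mono) auto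
  also have "\<dots> = (2 / 9 - 16 / 9 * \<rho>) * (t\<^sup>2 * P)"
    using L D by (simp add: \<rho> divide_simps) (simp add: algebra_simps)
  finally have 1: "\<rho> * (4 / (3 * L) * t\<^sup>2 * dz) \<le> (2 / 9 - 16 / 9 * \<rho>) * (t\<^sup>2 * P)" .
  have 2: "\<rho> * N \<le> \<rho> * (2 * (t * Q) + 8 / 9 * t\<^sup>2 * P)" using N \<rho>0 by simp
  have "2 * \<rho> \<le> 2 / 3 * (\<mu> / L)" using \<mu> L D by (simp add: \<rho> field_simps)
  then have "2 * \<rho> * (t * Q) \<le> 2 / 3 * (\<mu> / L) * (t * Q)"
    using t Q0 by (intro mult_right_mono) auto
  moreover have "0 \<le> \<rho> * (t\<^sup>2 * P)" using \<rho>0 P0 by simp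
  ultimately have absorb: "\<rho> * (4 / (3 * L) * t\<^sup>2 * dz + N) \<le> 2 / 9 * t\<^sup>2 * P + 2 / 3 * t * (\<mu> / L) * Q"
    using 1 2 unfolding Z_def[symmetric] by (simp add: algebra_simps)
  have "(1 + \<rho>) * (4 / (3 * L) * t\<^sup>2 * dn + N) \<le> (1 + \<rho>) * (4 / (3 * L) * t\<^sup>2 * dz + N)"
    using dn L \<rho>0 by (intro mult_left_mono add_right_mono) auto
  also have "\<dots> \<le> 4 / (3 * L) * (t * (t - 1)) * dy + W"
    using decrease absorb unfolding distrib_right mult_1 by linarith
  finally show ?thesis by (simp add: N_def W_def)
qed

text \<open>After multiplying by \<open>t_seq (Suc k)\<close>, the coefficients of
  \<open>y (Suc k)\<close> on the left sum to zero, so the identity holds whichever branch defines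
  \<open>y (Suc k)\<close>.\<close>

lemma m_apm_momentum:
  assumes "m_apm f g s \<gamma> x y z"
  shows "t_seq (Suc k) *\<^sub>R x (Suc k) - (t_seq (Suc k) - 1) *\<^sub>R y (Suc k)
    = t_seq k *\<^sub>R x k - (t_seq k - 1) *\<^sub>R y k - (\<gamma> * t_seq k) *\<^sub>R (x k - z k)"
proof -
  have t: "t_seq (Suc k) \<noteq> 0" using t_seq_ge_1[of "Suc k"] by linarith
  have "x (Suc k) = y (Suc k) + ((t_seq k - 1) / t_seq (Suc k)) *\<^sub>R (y (Suc k) - y k)
           + (t_seq k / t_seq (Suc k)) *\<^sub>R (z k - y (Suc k))
           + (t_seq k * (\<gamma> - 1) / t_seq (Suc k)) *\<^sub>R (z k - x k)"
    using assms unfolding m_apm_def by blast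
  then have "t_seq (Suc k) *\<^sub>R x (Suc k) = t_seq (Suc k) *\<^sub>R y (Suc k) + (t_seq k - 1) *\<^sub>R (y (Suc k) - y k)
      + t_seq k *\<^sub>R (z k - y (Suc k)) + (t_seq k * (\<gamma> - 1)) *\<^sub>R (z k - x k)"
    using t by (simp add: scaleR_add_right del: t_seq.simps)
  then show ?thesis by (simp add: algebra_simps del: t_seq.simps)
qed

theorem corollary9:
  fixes f :: "'a::{real_inner, complete_space} \<Rightarrow> real"
    and g :: "'a \<Rightarrow> ereal"
    and x y z :: "nat \<Rightarrow> 'a"
    and xstar :: 'a
    and L \<mu> \<rho> :: real
    and k :: nat
  assumes "L \<ge> \<mu>" and "\<mu> > 0"
    and "strongly_convex \<mu> f" and "smooth L f"
    and "convex_ext g" and "proper g" and "lsc g"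
    and "xstar \<in> argmin (composite f g)"
    and "m_apm f g (1 / L) (2 / 3) x y z"
    and "\<rho> = \<mu> / (3 * L + 5 * \<mu>)"
    and "k \<ge> 2"
  shows "composite f g (y k) - composite f g xstar
    \<le> ereal (3 * L * (norm (x 0 - xstar))\<^sup>2 / (4 * t_seq k * (t_seq k - 1))
        * (1 + \<rho>) powi (- int k + 2))"
proof -
  let ?F = "composite f g"
  let ?t = t_seq
  have L: "L > 0" using assms(1,2) by simp
  have \<rho>0: "\<rho> > 0" using assms(2,10) L by simp
  obtain m where m: "?F xstar = ereal m" "\<And>u. ereal m \<le> ?F u"
    using composite_argmin_finite[OF assms(6,8)] by blast
  have alg: "z j = prox (1 / L) g (x j - (1 / L) *\<^sub>R gradient f (x j))"
    "y (Suc j) = (if ?F (z j) \<le> ?F (y j) then z j else y j)" for j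
    using assms(9) unfolding m_apm_def by blast+
  have "\<exists>c. ?F (z j) = ereal c \<and> (\<forall>u b. ?F u = ereal b \<longrightarrow>
      c + L / 2 * (norm (x j - z j))\<^sup>2 + \<mu> / 2 * (norm (x j - u))\<^sup>2 \<le> b + L * inner (x j - z j) (x j - u))" for j
    using prox_gradient_inequality[OF assms(4,3) L assms(5-7) m(2) alg(1)] by metis
  then obtain c where c: "\<And>j. ?F (z j) = ereal (c j)"
    and step: "\<And>j u b. ?F u = ereal b \<Longrightarrow> c j + L / 2 * (norm (x j - z j))\<^sup>2 + \<mu> / 2 * (norm (x j - u))\<^sup>2
      \<le> b + L * inner (x j - z j) (x j - u)"
    by metis
  \<comment> \<open>If \<open>F (y 0)\<close> is infinite, \<open>d 0\<close> is the default 0; this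
    is harmless since \<open>d 0\<close> enters only with the factor
    \<open>t_seq 0 - 1 = 0\<close>.\<close>
  define d where "d = (\<lambda>j. real_of_ereal (?F (y j)))"
  have ySuc: "?F (y (Suc j)) \<le> ereal (c j)" for j
    using alg(2)[of j] c[of j] by (auto simp: not_le)
  have d: "?F (y (Suc j)) = ereal (d (Suc j))" for j
    using ySuc[of j] m(2)[of "y (Suc j)"] by (cases "?F (y (Suc j))") (auto simp: d_def)
  define v where "v = (\<lambda>j. ?t j *\<^sub>R x j - (?t j - 1) *\<^sub>R y j)"
  define E where "E = (\<lambda>j. 4 / (3 * L) * (?t j * (?t j - 1)) * (d j - m) + (norm (v j - xstar))\<^sup>2)"
  have E_step: "(1 + \<rho>) * E (Suc j) \<le> E j" for j
  proof -
    have w: "v j - xstar = (?t j - 1) *\<^sub>R (x j - y j) + (x j - xstar)"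
      by (simp add: v_def algebra_simps)
    have w': "v (Suc j) - xstar
        = (?t j - 1) *\<^sub>R (x j - y j) + (x j - xstar) - (2 / 3 * ?t j) *\<^sub>R (x j - z j)"
      unfolding w[symmetric] using m_apm_momentum[OF assms(9), of j] by (simp add: v_def)
    have "(?t j - 1) * (c j - m + L / 2 * (norm (x j - z j))\<^sup>2 + \<mu> / 2 * (norm (x j - y j))\<^sup>2)
        \<le> (?t j - 1) * (d j - m + L * inner (x j - z j) (x j - y j))"
    proof (cases j)
      case (Suc i)
      show ?thesis
        using step[OF d[of i], of j] t_seq_ge_1[of j] Suc by (intro mult_left_mono) auto
    qed simp
    moreover have "d (Suc j) - m \<le> c j - m" using ySuc[of j] d[of j] by simp
    moreover have "c j - m + L / 2 * (norm (x j - z j))\<^sup>2 + \<mu> / 2 * (norm (x j - xstar))\<^sup>2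
        \<le> L * inner (x j - z j) (x j - xstar)"
      using step[OF m(1), of j] by simp
    ultimately show ?thesis
      unfolding E_def w w' t_seq_Suc_mult
      by (intro energy_step[OF assms(2,1) t_seq_ge_1 assms(10)])
  qed
  have "(1 + \<rho>) ^ j * E j \<le> E 0" for j
  proof (induction j)
    case (Suc j)
    have "(1 + \<rho>) ^ j * ((1 + \<rho>) * E (Suc j)) \<le> (1 + \<rho>) ^ j * E j"
      using E_step \<rho>0 by (intro mult_left_mono) auto
    with Suc show ?case by (simp add: ac_simps)
  qed simp
  moreover have "E 0 = (norm (x 0 - xstar))\<^sup>2" by (simp add: E_def v_def)
  ultimately have Ek: "(1 + \<rho>) ^ k * E k \<le> (norm (x 0 - xstar))\<^sup>2" by metis
  obtain i where i: "k = Suc (Suc i)" using \<open>k \<ge> 2\<close> by (metis Suc_le_D numeral_2_eq_2 Suc_le_mono)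
  define T where "T = ?t k * (?t k - 1)"
  have T: "T > 0" using t_seq_Suc_mult[of "Suc i"] t_seq_ge_1[of "Suc i"] by (simp add: T_def i del: t_seq.simps)
  have gap: "d k - m \<ge> 0" using m(2)[of "y k"] d[of "Suc i"] i by simp
  \<comment> \<open>The distance term of \<open>E k\<close> is dropped, and two of the
    \<open>k\<close> factors \<open>1 + \<rho>\<close> are given away because
    \<open>i = k - 2\<close>.\<close>
  have "(1 + \<rho>) ^ i * (4 / (3 * L) * T * (d k - m)) \<le> (1 + \<rho>) ^ k * E k"
    using \<rho>0 L T gap i by (intro mult_mono power_increasing) (auto simp: E_def T_def simp del: t_seq.simps)
  also note Ek
  finally have "(d k - m) * (1 + \<rho>) ^ i \<le> 3 * L * (norm (x 0 - xstar))\<^sup>2 / (4 * T)"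
    using L T by (simp add: field_simps)
  then have "d k - m \<le> 3 * L * (norm (x 0 - xstar))\<^sup>2 / (4 * T) / (1 + \<rho>) ^ i"
    using \<rho>0 by (subst pos_le_divide_eq) auto
  moreover have "(1 + \<rho>) powi (- int k + 2) = 1 / (1 + \<rho>) ^ i"
    by (simp add: i power_int_minus inverse_eq_divide)
  ultimately have "d k - m \<le> 3 * L * (norm (x 0 - xstar))\<^sup>2 / (4 * ?t k * (?t k - 1)) * (1 + \<rho>) powi (- int k + 2)"
    by (simp add: T_def mult.assoc del: t_seq.simps)
  moreover have "?F (y k) - ?F xstar = ereal (d k - m)" using d[of "Suc i"] i m(1) by simp
  ultimately show ?thesis by simp
qed

end
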